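(* Consider the problem of minimizing $f=\sum_{i=1}^m f_i$ over $X$, and suppose that Assumption 1 (common optimal solution) and Assumption 2 (Hölder condition of order $p>0$) stated in the context hold. Let $\{x_k\}$ be a sequence generated by the incremental subgradient method described in the context with the diminishing stepsize rule, i.e. $v_k>0$, $\lim_{k\to\infty}v_k=0$ and $\sum_{k=0}^\infty v_k=\infty$. Then the following statements hold. (i) $\liminf_{k\to\infty}f(x_k)=f^*$. (ii) If $f$ is coercive (i.e. $\lim_{\|x\|\to\infty}f(x)=\infty$), then $\lim_{k\to\infty}f(x_k)=f^*$ and $\lim_{k\to\infty}\mathrm{dist}(x_k,X^* )=0$. (iii) If $\sum_{k=0}^\infty v_k^2<\infty$, then $\{x_k\}$ converges to an optimal solution of the problem, i.e. to a point of $X^*$.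
   Context: Setting. $X\subseteq\mathbb{R}^n$ is nonempty, closed and convex, and $f_1,\dots,f_m:\mathbb{R}^n\to\mathbb{R}$ are continuous and quasi-convex (a function $h$ is quasi-convex if $h((1-\alpha)x+\alpha y)\le\max\{h(x),h(y)\}$ for all $x,y\in\mathbb{R}^n$, $\alpha\in[0,1]$). Put $f:=\sum_{i=1}^m f_i$ ($f$ need not be quasi-convex), $f^*:=\min_{x\in X}f(x)$, $X^*:=\arg\min_{x\in X}f(x)$, $f_i^*:=\min_{x\in X}f_i(x)$, $X_i^*:=\arg\min_{x\in X}f_i(x)$. $\|\cdot\|$ is the Euclidean norm, $\mathrm{dist}(x,Z):=\inf_{z\in Z}\|x-z\|$, $P_X$ is the Euclidean projection onto $X$, and $S(0,1)$ the unit sphere. The index $k$ ranges over $\{0,1,2,\dots\}$. Assumption 1. The component functions have a common optimal solution over $X$ (equivalently $X^*=\bigcap_{i=1}^m X_i^*\neq\emptyset$). Assumption 2. $p>0$, $L_i>0$ for $i=1,\dots,m$, and for each $i$, $|f_i(y)-f_i(x)|\le L_i\|y-x\|^p$ for all $x\in X$ and all $y\in\mathbb{R}^n$. Quasi-subdifferential. For quasi-convex $h:\mathbb{R}^n\to\mathbb{R}$ and $x\in\mathbb{R}^n$, $\partial h(x):=\{g:\langle g,y-x\rangle\le 0\text{ for every } y \text{ with } h(y)<h(x)\}$. Incremental subgradient method. Initialize an initial point $x_0\in\mathbb{R}^n$, a stepsize sequence $\{v_k\}$, and $k:=0$. While $f(x_k)>f^*$: set $z_{k,0}:=x_k$; for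 $i=1,\dots,m$: if $f_i(z_{k,i-1})=f_i^*$, set $z_{k,i}:=z_{k,i-1}$; otherwise calculate $g_{k,i}\in\partial f_i(z_{k,i-1})\cap S(0,1)$ and set $z_{k,i}:=P_X(z_{k,i-1}-v_kg_{k,i})$. Then set $x_{k+1}:=z_{k,m}$ and $k:=k+1$. *)

theory Defs
  imports "HOL-Analysis.Analysis"
begin

definition quasi_convex :: "(real ^ 'n \<Rightarrow> real) \<Rightarrow> bool" where
  "quasi_convex h \<longleftrightarrow>
     (\<forall>x y. \<forall>\<alpha>\<in>{0..1}. h ((1 - \<alpha>) *\<^sub>R x + \<alpha> *\<^sub>R y) \<le> max (h x) (h y))"

(* LEAST is the minimum of the value set when h attains one on X; otherwise it is unspecified. *)
definition min_value :: "(real ^ 'n) set \<Rightarrow> (real ^ 'n \<Rightarrow> real) \<Rightarrow> real" where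
  "min_value X h = (LEAST c. c \<in> h ` X)"

definition argmin_set :: "(real ^ 'n) set \<Rightarrow> (real ^ 'n \<Rightarrow> real) \<Rightarrow> (real ^ 'n) set" where
  "argmin_set X h = {x. is_arg_min h (\<lambda>y. y \<in> X) x}"

definition quasi_subdifferential ::
    "(real ^ 'n \<Rightarrow> real) \<Rightarrow> real ^ 'n \<Rightarrow> (real ^ 'n) set" where
  "quasi_subdifferential h x = {g. \<forall>y. h y < h x \<longrightarrow> g \<bullet> (y - x) \<le> 0}"

definition total_objective :: "nat \<Rightarrow> (nat \<Rightarrow> real ^ 'n \<Rightarrow> real) \<Rightarrow> real ^ 'n \<Rightarrow> real" where
  "total_objective m f x = (\<Sum>i=1..m. f i x)"

(* One outer iteration with stepsize s, taking x to x'. Any choice of unit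
   quasi-subgradients is allowed, so this is a relation; closest_point X is the
   Euclidean projection onto X. *)
definition incremental_pass ::
    "(real ^ 'n) set \<Rightarrow> nat \<Rightarrow> (nat \<Rightarrow> real ^ 'n \<Rightarrow> real) \<Rightarrow> real \<Rightarrow> real ^ 'n \<Rightarrow> real ^ 'n \<Rightarrow> bool" where
  "incremental_pass X m f s x x' \<longleftrightarrow>
     (\<exists>z. z 0 = x \<and> z m = x' \<and>
       (\<forall>i\<in>{1..m}.
          if f i (z (i - 1)) = min_value X (f i) then z i = z (i - 1)
          else (\<exists>g \<in> quasi_subdifferential (f i) (z (i - 1)) \<inter> sphere 0 1.
                  z i = closest_point X (z (i - 1) - s *\<^sub>R g))))"

(* While the loop condition holds, x (Suc k) arises from x k by one pass. Once it
   fails the method stops, and the sequence is continued by its final iterate. *)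
definition incremental_subgradient_seq ::
    "(real ^ 'n) set \<Rightarrow> nat \<Rightarrow> (nat \<Rightarrow> real ^ 'n \<Rightarrow> real) \<Rightarrow> (nat \<Rightarrow> real) \<Rightarrow> (nat \<Rightarrow> real ^ 'n) \<Rightarrow> bool" where
  "incremental_subgradient_seq X m f v x \<longleftrightarrow>
     (\<forall>k. if total_objective m f (x k) > min_value X (total_objective m f)
          then incremental_pass X m f (v k) (x k) (x (Suc k))
          else x (Suc k) = x k)"

end

theory Submission
  imports Defs
begin

text \<open>
  The gap of a component controls how far a step turns towards the minimizers. Let \<open>z \<in> X\<close>,
  let \<open>g\<close> be a unit quasi-subgradient of \<open>f\<^sub>i\<close> at \<open>z\<close>, and let \<open>y\<close> minimize \<open>f\<^sub>i\<close> over \<open>X\<close>,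
  with \<open>f\<^sub>i y < f\<^sub>i z\<close>.
  The point \<open>y + r g\<close> with \<open>r = \<langle>g, z - y\<rangle>\<close> lies on the hyperplane through \<open>z\<close> orthogonal
  to \<open>g\<close>; the open strict sublevel set of \<open>f\<^sub>i\<close> at level \<open>f\<^sub>i z\<close> lies strictly on one side
  of this hyperplane. Hence \<open>f\<^sub>i z \<le> f\<^sub>i (y + r g)\<close>, and the Hoelder condition at \<open>y\<close> gives
  \<open>f\<^sub>i z - f\<^sub>i y \<le> L\<^sub>i r\<^sup>p\<close> (\<open>hoelder_gap_le\<close>). So a positive gap bounds \<open>r\<close> from below, and the
  projected step of length \<open>s\<close> changes the squared distance to \<open>y\<close> by at most \<open>s\<^sup>2 - 2 s r\<close>.

  Because the components share their minimizers, these changes may be added over a whole pass,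
  with the same \<open>y\<close> for all components. If \<open>f\<close> exceeds its minimum by at least \<open>\<epsilon>\<close> at the
  start of the pass, some component has a gap of at least \<open>\<epsilon> / m\<close> there. The points of a pass
  are within \<open>m s\<close> of its start, so for small \<open>s\<close> this component still has half of that gap
  when its turn comes. Thus every pass satisfies
  \<open>\<parallel>x' - y\<parallel>\<^sup>2 \<le> \<parallel>x - y\<parallel>\<^sup>2 + m s\<^sup>2\<close>, and at points that are \<open>\<epsilon>\<close>-far from optimal and for small
  \<open>s\<close> even \<open>\<parallel>x' - y\<parallel>\<^sup>2 \<le> \<parallel>x - y\<parallel>\<^sup>2 - \<delta> s\<close> with \<open>\<delta>\<close> depending only on \<open>\<epsilon>\<close>
  (\<open>incremental_pass_estimates\<close>).

  The three statements follow from these two inequalities and the bound \<open>m s\<close> on the length of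
  a pass (locale \<open>quasi_fejer\<close>). If the
  values stayed above the minimum by \<open>\<epsilon>\<close>, the squared distances would drop by \<open>\<delta> \<Sum>v\<^sub>k = \<infinity>\<close>.
  For coercive \<open>f\<close>, points of \<open>X\<close> far from the minimizers have values bounded away from the
  minimum, so the distance can only grow close to the minimizers, and there by no more than the
  vanishing step length. If \<open>\<Sum>v\<^sub>k\<^sup>2 < \<infinity>\<close>, the distance to every minimizer converges; by the
  first statement some cluster point is a minimizer, and the distance to that one converges to 0.
\<close>

section \<open>Two facts on real sequences\<close>

text \<open>Telescoping: the total decrease is \<open>\<delta>\<close> times the partial sums of \<open>v\<close>, hence unbounded.\<close>
lemma no_divergent_descent:
  fixes a v :: "nat \<Rightarrow> real"
  assumes "\<delta> > 0" "\<And>k. a k \<ge> 0"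
    and dec: "eventually (\<lambda>k. a (Suc k) \<le> a k - v k * \<delta>) sequentially"
    and div: "filterlim (\<lambda>N. \<Sum>k<N. v k) at_top sequentially"
  shows False
proof -
  obtain K where K: "\<And>k. k \<ge> K \<Longrightarrow> a (Suc k) \<le> a k - v k * \<delta>"
    using dec by (auto simp: eventually_sequentially)
  have le: "a n + \<delta> * (\<Sum>k<n. v k) \<le> a K + \<delta> * (\<Sum>k<K. v k)" if "n \<ge> K" for n
    using that
  proof (induction rule: dec_induct)
    case (step n)
    then show ?case using K[of n] by (simp add: algebra_simps)
  qed simp
  have "eventually (\<lambda>n. (\<Sum>k<n. v k) > (a K + \<delta> * (\<Sum>k<K. v k)) / \<delta>) sequentially"
    using div by (simp add: filterlim_at_top_dense)
  then obtain n where "n \<ge> K" and n: "(\<Sum>k<n. v k) > (a K + \<delta> * (\<Sum>k<K. v k)) / \<delta>"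
    using eventually_happens'[OF sequentially_bot eventually_conj[OF eventually_ge_at_top[of K]]]
    by blast
  have "\<delta> * (\<Sum>k<n. v k) > a K + \<delta> * (\<Sum>k<K. v k)"
    using n \<open>\<delta> > 0\<close> by (simp add: pos_divide_less_eq mult.commute)
  with le[OF \<open>n \<ge> K\<close>] assms(2)[of n] show False by linarith
qed

text \<open>Subtracting the partial sums of \<open>u\<close> makes \<open>a\<close> eventually decreasing and bounded below.\<close>
lemma convergent_of_summable_increase:
  fixes a u :: "nat \<Rightarrow> real"
  assumes "\<And>k. a k \<ge> 0" "\<And>k. u k \<ge> 0" "summable u"
    and inc: "eventually (\<lambda>k. a (Suc k) \<le> a k + u k) sequentially"
  shows "convergent a"
proof -
  obtain K where K: "\<And>k. k \<ge> K \<Longrightarrow> a (Suc k) \<le> a k + u k"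
    using inc by (auto simp: eventually_sequentially)
  define b where "b n = a n - (\<Sum>j<n. u j)" for n
  have "decseq (\<lambda>n. b (n + K))"
    by (intro decseq_SucI) (use K in \<open>simp add: b_def diff_le_eq\<close>)
  moreover have "b (n + K) \<ge> - suminf u" for n
    using sum_le_suminf[of u "{..<n+K}"] assms(1)[of "n + K"] assms(2,3)
    by (simp add: b_def)
  ultimately obtain l where "(\<lambda>n. b (n + K)) \<longlonglongrightarrow> l"
    using decseq_convergent by metis
  then have "b \<longlonglongrightarrow> l" by (simp add: LIMSEQ_offset)
  then have "(\<lambda>n. b n + (\<Sum>j<n. u j)) \<longlonglongrightarrow> l + suminf u"
    using assms(3) by (intro tendsto_add summable_LIMSEQ)
  then show ?thesis by (auto simp: b_def convergent_def)
qed

section \<open>Quasi-Fejer sequences with diminishing steps\<close>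

text \<open>
  The convergence statements depend on the method only through these inequalities. They are
  required eventually, which absorbs an infeasible starting point and steps that are too large
  for the descent at a given \<open>\<epsilon>\<close>. A sequence that stops at a minimizer also satisfies them: there
  \<open>step_le\<close> and \<open>fejer\<close> hold because the iterate no longer moves, and the premise of \<open>descent\<close>
  fails.
\<close>
locale quasi_fejer =
  fixes X :: "'a::euclidean_space set" and F :: "'a \<Rightarrow> real" and Fmin c :: real
    and v :: "nat \<Rightarrow> real" and x :: "nat \<Rightarrow> 'a" and S :: "'a set"
  assumes closed_X: "closed X"
    and cont: "continuous_on X F"
    and S_eq: "S = {y \<in> X. F y = Fmin}"
    and S_nonempty: "S \<noteq> {}"
    and Fmin_le: "\<And>y. y \<in> X \<Longrightarrow> Fmin \<le> F y"
    and c_nonneg: "c \<ge> 0"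
    and v_pos: "\<And>k. v k > 0"
    and v_null: "v \<longlonglongrightarrow> 0"
    and v_div: "filterlim (\<lambda>N. \<Sum>k<N. v k) at_top sequentially"
    and in_X: "eventually (\<lambda>k. x k \<in> X) sequentially"
    and step_le: "eventually (\<lambda>k. norm (x (Suc k) - x k) \<le> c * v k) sequentially"
    and fejer: "eventually (\<lambda>k. \<forall>y\<in>S. (norm (x (Suc k) - y))\<^sup>2
                  \<le> (norm (x k - y))\<^sup>2 + c * (v k)\<^sup>2) sequentially"
    and descent: "\<And>\<epsilon>. \<epsilon> > 0 \<Longrightarrow> \<exists>\<delta>>0. eventually (\<lambda>k. F (x k) \<ge> Fmin + \<epsilon> \<longrightarrow>
                  (\<forall>y\<in>S. (norm (x (Suc k) - y))\<^sup>2 \<le> (norm (x k - y))\<^sup>2 - v k * \<delta>)) sequentially"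
begin

lemma frequently_near_min:
  assumes "\<epsilon> > 0"
  shows "frequently (\<lambda>k. F (x k) < Fmin + \<epsilon>) sequentially"
proof (rule ccontr)
  assume "\<not> frequently (\<lambda>k. F (x k) < Fmin + \<epsilon>) sequentially"
  then have ge: "eventually (\<lambda>k. F (x k) \<ge> Fmin + \<epsilon>) sequentially"
    by (simp add: not_frequently not_less)
  obtain y where y: "y \<in> S" using S_nonempty by blast
  obtain \<delta> where \<delta>: "\<delta> > 0" and ev: "eventually (\<lambda>k. F (x k) \<ge> Fmin + \<epsilon> \<longrightarrow>
      (\<forall>y\<in>S. (norm (x (Suc k) - y))\<^sup>2 \<le> (norm (x k - y))\<^sup>2 - v k * \<delta>)) sequentially"
    using descent[OF assms] by blast
  have "eventually (\<lambda>k. (norm (x (Suc k) - y))\<^sup>2 \<le> (norm (x k - y))\<^sup>2 - v k * \<delta>) sequentially"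
    using ge ev by eventually_elim (use y in blast)
  then show False
    using no_divergent_descent[OF \<delta>, of "\<lambda>k. (norm (x k - y))\<^sup>2" v] v_div by simp
qed

lemma liminf_eq: "liminf (\<lambda>k. ereal (F (x k))) = ereal Fmin"
proof (rule antisym)
  have "eventually (\<lambda>k. ereal Fmin \<le> ereal (F (x k))) sequentially"
    using in_X by eventually_elim (simp add: Fmin_le)
  then show "ereal Fmin \<le> liminf (\<lambda>k. ereal (F (x k)))"
    by (rule Liminf_bounded)
  show "liminf (\<lambda>k. ereal (F (x k))) \<le> ereal Fmin"
  proof (rule ereal_le_epsilon2)
    fix \<epsilon> :: real assume "\<epsilon> > 0"
    show "liminf (\<lambda>k. ereal (F (x k))) \<le> ereal Fmin + ereal \<epsilon>"
    proof (rule ccontr)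
      assume "\<not> ?thesis"
      then have "eventually (\<lambda>k. ereal Fmin + ereal \<epsilon> < ereal (F (x k))) sequentially"
        by (intro less_LiminfD) simp
      then have "eventually (\<lambda>k. \<not> F (x k) < Fmin + \<epsilon>) sequentially"
        by eventually_elim simp
      with frequently_near_min[OF \<open>\<epsilon> > 0\<close>] show False
        by (simp add: frequently_def)
    qed
  qed
qed

lemma closed_S: "closed S"
  unfolding S_eq using continuous_closed_preimage[OF cont closed_X closed_singleton[of Fmin]]
  by (simp add: vimage_def Int_def)

lemma bounded_sublevel:
  assumes "filterlim F at_top at_infinity"
  shows "bounded {y. F y \<le> C}"
proof -
  have "eventually (\<lambda>y. F y > C) at_infinity"
    using assms by (simp add: filterlim_at_top_dense)
  then obtain B where "\<And>y. norm y \<ge> B \<Longrightarrow> F y > C"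
    by (auto simp: eventually_at_infinity)
  then have "\<forall>y\<in>{y. F y \<le> C}. norm y \<le> B"
    by (metis linorder_not_le mem_Collect_eq nle_le)
  then show ?thesis by (auto simp: bounded_iff)
qed

text \<open>
  Coercivity makes the relevant part of a sublevel set compact, so \<open>F\<close> attains a minimum
  on it unless it is empty. This minimum exceeds \<open>Fmin\<close> because the set misses \<open>S\<close>.
\<close>
lemma gap_away_from_S:
  assumes coercive: "filterlim F at_top at_infinity" and "\<eta> > 0"
  obtains \<epsilon> where "\<epsilon> > 0" "\<And>y. y \<in> X \<Longrightarrow> infdist y S \<ge> \<eta> \<Longrightarrow> F y \<ge> Fmin + \<epsilon>"
proof -
  define K where "K = {y \<in> X. F y \<le> Fmin + 1} \<inter> {y. \<eta> \<le> infdist y S}"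
  have "closed {y \<in> X. F y \<le> Fmin + 1}"
    using continuous_closed_preimage[OF cont closed_X closed_atMost[of "Fmin + 1"]]
    by (simp add: vimage_def Int_def)
  moreover have "closed {y. \<eta> \<le> infdist y S}"
    by (intro closed_Collect_le continuous_intros)
  ultimately have "closed K" by (simp add: K_def closed_Int)
  moreover have "bounded K"
    using bounded_sublevel[OF coercive] by (rule bounded_subset) (auto simp: K_def)
  ultimately have "compact K" by (simp add: compact_eq_bounded_closed)
  show ?thesis
  proof (cases "K = {}")
    case True
    then have "F y \<ge> Fmin + 1" if "y \<in> X" "infdist y S \<ge> \<eta>" for y
      using that by (force simp: K_def)
    then show ?thesis using that[of 1] by simp
  next
    case False
    have "continuous_on K F" using cont by (rule continuous_on_subset) (auto simp: K_def)
    from continuous_attains_inf[OF \<open>compact K\<close> False this]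
    obtain u where u: "u \<in> K" "\<And>y. y \<in> K \<Longrightarrow> F u \<le> F y" by blast
    have "u \<notin> S" using u(1) \<open>\<eta> > 0\<close> by (auto simp: K_def)
    then have "F u > Fmin" using u(1) Fmin_le[of u] by (auto simp: K_def S_eq)
    moreover have "F y \<ge> Fmin + min 1 (F u - Fmin)" if "y \<in> X" "infdist y S \<ge> \<eta>" for y
      using u(2)[of y] that by (cases "F y \<le> Fmin + 1") (auto simp: K_def)
    ultimately show ?thesis using that[of "min 1 (F u - Fmin)"] by simp
  qed
qed

text \<open>
  Once the distance is below \<open>\<eta>\<close>, it stays there: from below \<open>\<eta> / 2\<close> a short step cannot
  cross \<open>\<eta>\<close>, and between \<open>\<eta> / 2\<close> and \<open>\<eta>\<close> the value is bounded away from the minimum, so the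
  descent condition keeps the distance from growing. It does get below \<open>\<eta>\<close>, since the values come near the minimum.
\<close>
lemma coercive_infdist_tendsto:
  assumes coercive: "filterlim F at_top at_infinity"
  shows "(\<lambda>k. infdist (x k) S) \<longlonglongrightarrow> 0"
proof (rule LIMSEQ_I)
  fix \<eta> :: real assume "\<eta> > 0"
  then obtain \<epsilon> where \<epsilon>: "\<epsilon> > 0" "\<And>y. y \<in> X \<Longrightarrow> infdist y S \<ge> \<eta> / 2 \<Longrightarrow> F y \<ge> Fmin + \<epsilon>"
    using gap_away_from_S[OF coercive, of "\<eta> / 2"] by auto
  obtain \<delta> where "\<delta> > 0" and ev: "eventually (\<lambda>k. F (x k) \<ge> Fmin + \<epsilon> \<longrightarrow>
      (\<forall>y\<in>S. (norm (x (Suc k) - y))\<^sup>2 \<le> (norm (x k - y))\<^sup>2 - v k * \<delta>)) sequentially"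
    using descent[OF \<epsilon>(1)] by blast
  have "(\<lambda>k. c * v k) \<longlonglongrightarrow> 0" using tendsto_mult_right_zero[OF v_null] .
  then have "eventually (\<lambda>k. c * v k < \<eta> / 2) sequentially"
    using \<open>\<eta> > 0\<close> by (intro order_tendstoD) auto
  then have "eventually (\<lambda>k. (F (x k) \<ge> Fmin + \<epsilon> \<longrightarrow>
      (\<forall>y\<in>S. (norm (x (Suc k) - y))\<^sup>2 \<le> (norm (x k - y))\<^sup>2 - v k * \<delta>))
      \<and> norm (x (Suc k) - x k) < \<eta> / 2 \<and> x k \<in> X) sequentially"
    using ev step_le in_X by eventually_elim auto
  then obtain K where K: "\<And>k. k \<ge> K \<Longrightarrow> F (x k) \<ge> Fmin + \<epsilon> \<Longrightarrow>
      (\<forall>y\<in>S. (norm (x (Suc k) - y))\<^sup>2 \<le> (norm (x k - y))\<^sup>2 - v k * \<delta>)"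
    "\<And>k. k \<ge> K \<Longrightarrow> norm (x (Suc k) - x k) < \<eta> / 2" "\<And>k. k \<ge> K \<Longrightarrow> x k \<in> X"
    unfolding eventually_sequentially by blast
  have stay: "infdist (x (Suc k)) S < \<eta>" if "k \<ge> K" "infdist (x k) S < \<eta>" for k
  proof (cases "infdist (x k) S < \<eta> / 2")
    case True
    have "infdist (x (Suc k)) S \<le> infdist (x k) S + dist (x (Suc k)) (x k)"
      by (rule infdist_triangle)
    then show ?thesis using True K(2)[OF \<open>k \<ge> K\<close>] by (simp add: dist_norm)
  next
    case False
    then have F: "F (x k) \<ge> Fmin + \<epsilon>" using \<epsilon>(2) K(3) \<open>k \<ge> K\<close> by simp
    obtain y where y: "y \<in> S" "infdist (x k) S = dist (x k) y"
      using infdist_attains_inf[OF closed_S S_nonempty] by blast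
    have "(norm (x (Suc k) - y))\<^sup>2 \<le> (norm (x k - y))\<^sup>2 - v k * \<delta>"
      using K(1)[OF \<open>k \<ge> K\<close> F] y(1) by blast
    also have "\<dots> \<le> (norm (x k - y))\<^sup>2" using v_pos[of k] \<open>\<delta> > 0\<close> by simp
    finally have "norm (x (Suc k) - y) \<le> norm (x k - y)" by simp
    then show ?thesis
      using infdist_le[OF y(1), of "x (Suc k)"] y(2) that(2) by (simp add: dist_norm)
  qed
  obtain k0 where "k0 \<ge> K" "F (x k0) < Fmin + \<epsilon>"
    using frequently_near_min[OF \<epsilon>(1)] unfolding frequently_sequentially by blast
  then have start: "infdist (x k0) S < \<eta>"
    using \<epsilon>(2)[of "x k0"] K(3)[of k0] \<open>\<eta> > 0\<close> by (smt (verit) field_sum_of_halves)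
  have "infdist (x k) S < \<eta>" if "k \<ge> k0" for k
    using that by (induction rule: dec_induct) (use start stay \<open>k0 \<ge> K\<close> in auto)
  then show "\<exists>no. \<forall>n\<ge>no. norm (infdist (x n) S - 0) < \<eta>"
    by (auto simp: infdist_nonneg intro!: exI[of _ k0])
qed

text \<open>
  The compact set of minimizers has positive distance from the closed set where \<open>F\<close> is at
  least \<open>a > Fmin\<close>, so iterates close to the minimizers have values below \<open>a\<close>.
\<close>
lemma coercive_value_tendsto:
  assumes coercive: "filterlim F at_top at_infinity"
  shows "(\<lambda>k. F (x k)) \<longlonglongrightarrow> Fmin"
proof (rule order_tendstoI)
  fix a assume "a < Fmin"
  show "eventually (\<lambda>k. a < F (x k)) sequentially"
    using in_X by eventually_elim (use \<open>a < Fmin\<close> Fmin_le in force)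
next
  fix a assume "Fmin < a"
  have compact: "compact S"
    using bounded_subset[OF bounded_sublevel[OF coercive, of Fmin], of S] closed_S
    by (auto simp: S_eq compact_eq_bounded_closed)
  have closed: "closed {y \<in> X. a \<le> F y}"
    using continuous_closed_preimage[OF cont closed_X closed_atLeast[of a]]
    by (simp add: vimage_def Int_def)
  have "S \<inter> {y \<in> X. a \<le> F y} = {}" using \<open>Fmin < a\<close> by (auto simp: S_eq)
  then obtain d where d: "d > 0"
    "\<And>y z. y \<in> S \<Longrightarrow> z \<in> {y \<in> X. a \<le> F y} \<Longrightarrow> d \<le> dist y z"
    using separate_compact_closed[OF compact closed] by blast
  have "eventually (\<lambda>k. infdist (x k) S < d) sequentially"
    using coercive_infdist_tendsto[OF coercive] d(1) by (rule order_tendstoD)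
  then show "eventually (\<lambda>k. F (x k) < a) sequentially"
    using in_X
  proof eventually_elim
    case (elim k)
    obtain y where "y \<in> S" "infdist (x k) S = dist (x k) y"
      using infdist_attains_inf[OF closed_S S_nonempty] by blast
    then show ?case using d(2)[of y "x k"] elim by (force simp: dist_commute)
  qed
qed

text \<open>
  The distance to each minimizer converges. Therefore the sequence is bounded, and a subsequence
  along which the values tend to \<open>Fmin\<close> has a cluster point \<open>z\<close>, which is a minimizer.
  The distance to \<open>z\<close> converges and tends to 0 along a subsequence.
\<close>
lemma square_summable_tendsto:
  assumes "summable (\<lambda>k. (v k)\<^sup>2)"
  obtains z where "z \<in> S" "x \<longlonglongrightarrow> z"
proof -
  have conv: "convergent (\<lambda>k. (norm (x k - y))\<^sup>2)" if "y \<in> S" for y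
  proof (rule convergent_of_summable_increase)
    show "summable (\<lambda>k. c * (v k)\<^sup>2)" using assms by (rule summable_mult)
    show "eventually (\<lambda>k. (norm (x (Suc k) - y))\<^sup>2 \<le> (norm (x k - y))\<^sup>2 + c * (v k)\<^sup>2) sequentially"
      using fejer by eventually_elim (use that in blast)
  qed (use c_nonneg in auto)
  obtain y where "y \<in> S" using S_nonempty by blast
  obtain B where B: "\<And>k. (norm (x k - y))\<^sup>2 \<le> B"
    using convergent_imp_Bseq[OF conv[OF \<open>y \<in> S\<close>]] by (auto simp: Bseq_def)
  have "dist y (x k) \<le> sqrt B" for k
    using real_le_rsqrt[OF B[of k]] by (simp add: dist_norm norm_minus_commute)
  then have "bounded (range x)" by (auto simp: bounded_def)
  obtain r where r: "strict_mono r" "((\<lambda>k. ereal (F (x k))) \<circ> r) \<longlonglongrightarrow> ereal Fmin"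
    using liminf_subseq_lim[of "\<lambda>k. ereal (F (x k))"] unfolding liminf_eq by blast
  have "bounded (range (x \<circ> r))" using \<open>bounded (range x)\<close> by (rule bounded_subset) auto
  then obtain z q where q: "strict_mono q" "((x \<circ> r) \<circ> q) \<longlonglongrightarrow> z"
    using bounded_imp_convergent_subsequence by blast
  define w where "w = r \<circ> q"
  have w: "strict_mono w" using r(1) q(1) by (simp add: w_def strict_mono_o)
  have xw: "(\<lambda>n. x (w n)) \<longlonglongrightarrow> z" using q(2) by (simp add: w_def o_def)
  have "(\<lambda>n. ereal (F (x (w n)))) \<longlonglongrightarrow> ereal Fmin"
    using LIMSEQ_subseq_LIMSEQ[OF r(2) q(1)] by (simp add: w_def o_def)
  then have Fw: "(\<lambda>n. F (x (w n))) \<longlonglongrightarrow> Fmin" by simp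
  have wX: "eventually (\<lambda>n. x (w n) \<in> X) sequentially"
    using filterlim_subseq[OF w] in_X by (rule eventually_compose_filterlim[rotated])
  then have "z \<in> X" by (rule Lim_in_closed_set[OF closed_X _ sequentially_bot xw])
  then have "(\<lambda>n. F (x (w n))) \<longlonglongrightarrow> F z"
    using continuous_on_tendsto_compose[OF cont xw _ wX] by simp
  then have "F z = Fmin" using Fw LIMSEQ_unique by blast
  with \<open>z \<in> X\<close> have "z \<in> S" by (simp add: S_eq)
  obtain l where l: "(\<lambda>k. (norm (x k - z))\<^sup>2) \<longlonglongrightarrow> l"
    using conv[OF \<open>z \<in> S\<close>] by (auto simp: convergent_def)
  have "(\<lambda>n. (norm (x (w n) - z))\<^sup>2) \<longlonglongrightarrow> l"
    using LIMSEQ_subseq_LIMSEQ[OF l w] by (simp add: o_def)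
  moreover have "(\<lambda>n. (norm (x (w n) - z))\<^sup>2) \<longlonglongrightarrow> (norm (z - z))\<^sup>2"
    by (intro tendsto_intros xw)
  ultimately have "l = (norm (z - z))\<^sup>2" by (rule LIMSEQ_unique)
  then have "l = 0" by simp
  then have "(\<lambda>k. sqrt ((norm (x k - z))\<^sup>2)) \<longlonglongrightarrow> sqrt 0"
    using l by (intro tendsto_real_sqrt) simp
  then have "(\<lambda>k. x k - z) \<longlonglongrightarrow> 0" by (simp add: tendsto_norm_zero_iff)
  then have "x \<longlonglongrightarrow> z" by (simp add: LIM_zero_iff)
  then show ?thesis using that \<open>z \<in> S\<close> by blast
qed

end

section \<open>One projected quasi-subgradient step\<close>

text \<open>
  The definition gives only a weak inequality; it is strict because the sublevel set is open, so
  that \<open>y\<close> can be moved a little in direction \<open>g\<close> without leaving it.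
\<close>
lemma quasi_subgradient_inner_less:
  assumes "continuous_on UNIV h" "g \<in> quasi_subdifferential h z" "norm g = 1" "h y < h z"
  shows "g \<bullet> (y - z) < 0"
proof -
  have "open {u. h u < h z}"
    using assms(1) by (intro open_Collect_less) auto
  then obtain e where e: "e > 0" "cball y e \<subseteq> {u. h u < h z}"
    using assms(4) open_contains_cball by blast
  have "y + e *\<^sub>R g \<in> cball y e" using assms(3) e(1) by (simp add: dist_norm)
  then have "g \<bullet> (y + e *\<^sub>R g - z) \<le> 0"
    using e(2) assms(2) by (auto simp: quasi_subdifferential_def)
  moreover have "g \<bullet> (y + e *\<^sub>R g - z) = g \<bullet> (y - z) + e"
    using assms(3) by (simp add: inner_simps dot_square_norm)
  ultimately show ?thesis using e(1) by linarith
qed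

text \<open>
  The point \<open>y + r g\<close> is the foot of the perpendicular from \<open>y\<close> to the hyperplane through \<open>z\<close> with
  normal \<open>g\<close>. It has distance \<open>r\<close> from \<open>y\<close>, and by the previous lemma it lies outside the strict
  sublevel set of \<open>z\<close>.
\<close>
lemma hoelder_gap_le:
  assumes "continuous_on UNIV h" "g \<in> quasi_subdifferential h z" "norm g = 1" "h y < h z"
    and hoelder: "\<And>b. \<bar>h b - h y\<bar> \<le> L * norm (b - y) powr p"
  shows "h z - h y \<le> L * (g \<bullet> (z - y)) powr p"
proof -
  define r where "r = g \<bullet> (z - y)"
  have "r > 0"
    using quasi_subgradient_inner_less[OF assms(1-4)] by (simp add: r_def inner_simps)
  have "g \<bullet> (y + r *\<^sub>R g - z) = 0"
    using assms(3) by (simp add: r_def inner_simps dot_square_norm)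
  then have "h z \<le> h (y + r *\<^sub>R g)"
    using quasi_subgradient_inner_less[OF assms(1-3), of "y + r *\<^sub>R g"] by force
  with hoelder[of "y + r *\<^sub>R g"] show ?thesis
    using assms(3) \<open>r > 0\<close> by (simp add: r_def)
qed

text \<open>Projection onto \<open>X\<close> is nonexpansive and fixes \<open>y\<close>.\<close>
lemma projected_step_dist:
  fixes g :: "'a::euclidean_space"
  assumes "closed X" "convex X" "y \<in> X" "norm g = 1"
  shows "(norm (closest_point X (z - s *\<^sub>R g) - y))\<^sup>2
           \<le> (norm (z - y))\<^sup>2 - 2 * s * (g \<bullet> (z - y)) + s\<^sup>2"
proof -
  have "norm (closest_point X (z - s *\<^sub>R g) - y) \<le> norm (z - s *\<^sub>R g - y)"
    using closest_point_lipschitz[OF assms(2,1), of "z - s *\<^sub>R g" y] closest_point_self[OF assms(3)] assms(3)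
    by (auto simp: dist_norm)
  then have "(norm (closest_point X (z - s *\<^sub>R g) - y))\<^sup>2 \<le> (norm ((z - y) - s *\<^sub>R g))\<^sup>2"
    by (simp add: algebra_simps power_mono)
  also have "\<dots> = (norm (z - y))\<^sup>2 - 2 * s * (g \<bullet> (z - y)) + s\<^sup>2"
  proof -
    have "g \<bullet> g = 1" using assms(4) by (simp add: dot_square_norm)
    then show ?thesis
      unfolding power2_norm_eq_inner by (simp add: inner_simps inner_commute power2_eq_square algebra_simps)
  qed
  finally show ?thesis .
qed

section \<open>Minimizers of a sum with a common minimizer\<close>

lemma mem_argmin_set_iff: "y \<in> argmin_set X h \<longleftrightarrow> y \<in> X \<and> (\<forall>u\<in>X. h y \<le> h u)"
  by (auto simp: argmin_set_def is_arg_min_def not_less)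

lemma min_value_eq: "y \<in> argmin_set X h \<Longrightarrow> min_value X h = h y"
  unfolding min_value_def by (intro Least_equality) (auto simp: mem_argmin_set_iff)

lemma argmin_set_eq:
  assumes "argmin_set X h \<noteq> {}"
  shows "argmin_set X h = {y \<in> X. h y = min_value X h}"
proof -
  obtain w where w: "w \<in> argmin_set X h" using assms by blast
  show ?thesis using w min_value_eq[OF w] by (force simp: mem_argmin_set_iff)
qed

text \<open>
  At a common minimizer \<open>w\<close> every summand is minimal, so equality of the sums at \<open>w\<close> and at
  another minimizer of the total forces equality of all summands.
\<close>
lemma argmin_total_objective:
  assumes "(\<Inter>i\<in>{1..m}. argmin_set X (f i)) \<noteq> {}" "m \<ge> 1"
  shows "argmin_set X (total_objective m f) = (\<Inter>i\<in>{1..m}. argmin_set X (f i))"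
    and "min_value X (total_objective m f) = (\<Sum>i=1..m. min_value X (f i))"
proof -
  obtain w where w: "\<And>i. i \<in> {1..m} \<Longrightarrow> w \<in> argmin_set X (f i)" using assms(1) by blast
  have wX: "w \<in> X" using w[of 1] assms(2) by (simp add: mem_argmin_set_iff)
  have wT: "w \<in> argmin_set X (total_objective m f)"
    using w wX by (auto simp: mem_argmin_set_iff total_objective_def intro!: sum_mono)
  show min: "min_value X (total_objective m f) = (\<Sum>i=1..m. min_value X (f i))"
    using min_value_eq[OF wT] min_value_eq[OF w] by (simp add: total_objective_def)
  show "argmin_set X (total_objective m f) = (\<Inter>i\<in>{1..m}. argmin_set X (f i))"
  proof (intro set_eqI iffI)
    fix y assume "y \<in> (\<Inter>i\<in>{1..m}. argmin_set X (f i))"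
    then show "y \<in> argmin_set X (total_objective m f)"
      using assms(2) by (auto simp: mem_argmin_set_iff total_objective_def intro!: sum_mono)
  next
    fix y assume y: "y \<in> argmin_set X (total_objective m f)"
    then have "y \<in> X" by (simp add: mem_argmin_set_iff)
    have le: "f i w \<le> f i y" if "i \<in> {1..m}" for i
      using w[OF that] \<open>y \<in> X\<close> by (simp add: mem_argmin_set_iff)
    have "(\<Sum>i=1..m. f i w) = (\<Sum>i=1..m. f i y)"
      using min_value_eq[OF y] min_value_eq[OF wT] by (simp add: total_objective_def)
    then have eq: "f i w = f i y" if "i \<in> {1..m}" for i
      using sum_mono_inv[of "\<lambda>i. f i w" "{1..m}" "\<lambda>i. f i y"] le that by auto
    show "y \<in> (\<Inter>i\<in>{1..m}. argmin_set X (f i))"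
      using w eq \<open>y \<in> X\<close> by (auto simp: mem_argmin_set_iff)
  qed
qed

section \<open>One pass through the components\<close>

lemma powr_small:
  fixes C p e :: real
  assumes "p > 0" "e > 0" "C > 0"
  obtains \<delta> where "\<delta> > 0" "\<And>r. 0 \<le> r \<Longrightarrow> r \<le> \<delta> \<Longrightarrow> C * r powr p < e"
proof
  show "(e / (2 * C)) powr (1 / p) > 0" using assms by simp
  fix r assume "0 \<le> r" "r \<le> (e / (2 * C)) powr (1 / p)"
  then have "r powr p \<le> ((e / (2 * C)) powr (1 / p)) powr p"
    using assms by (intro powr_mono2) auto
  also have "\<dots> = e / (2 * C)" using assms by (simp add: powr_powr)
  finally show "C * r powr p < e" using assms by (simp add: field_simps)
qed

text \<open>
  The index \<open>i0\<close> marks a step with an additional decrease \<open>t\<close>; with \<open>t = 0\<close> this is the plain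
  telescoped bound.
\<close>
lemma chain_estimate:
  fixes D :: "nat \<Rightarrow> real"
  assumes "\<And>i. i \<in> {1..m} \<Longrightarrow> D i \<le> D (i - 1) + s"
    and "i0 \<in> {1..m}" "D i0 \<le> D (i0 - 1) + s - t"
  shows "D m \<le> D 0 + real m * s - t"
proof -
  have "D j \<le> D 0 + real j * s - (if i0 \<le> j then t else 0)" if "j \<le> m" for j
    using that
  proof (induction j)
    case 0
    then show ?case using assms(2) by auto
  next
    case (Suc j)
    then show ?case using assms(1)[of "Suc j"] assms(2,3)
      by (cases "i0 = Suc j") (auto simp: algebra_simps)
  qed
  from this[of m] show ?thesis using assms(2) by simp
qed

text \<open>
  In the last estimate the threshold \<open>\<delta>\<close> is used twice. As a bound on the length \<open>m s\<close> of the
  pass it ensures that a component with gap \<open>\<epsilon> / m\<close> at \<open>a\<close> keeps the gap \<open>\<epsilon> / (2 m)\<close> until its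
  turn; as a bound on \<open>r\<close> it shows that this component then contributes \<open>- 2 s \<delta>\<close>, half of
  which absorbs the error \<open>m s\<^sup>2 \<le> s \<delta>\<close> of the whole pass.
\<close>
lemma incremental_pass_estimates:
  fixes f :: "nat \<Rightarrow> real ^ 'n \<Rightarrow> real"
  assumes X: "closed X" "convex X" and s: "s > 0" and a: "a \<in> X"
    and cont: "\<And>i. i \<in> {1..m} \<Longrightarrow> continuous_on UNIV (f i)"
    and common: "(\<Inter>i\<in>{1..m}. argmin_set X (f i)) \<noteq> {}"
    and hoelder: "\<And>i u b. i \<in> {1..m} \<Longrightarrow> u \<in> X \<Longrightarrow>
                    \<bar>f i b - f i u\<bar> \<le> C * norm (b - u) powr p"
    and m: "m \<ge> 1"
    and pass: "incremental_pass X m f s a a'"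
  shows "a' \<in> X" and "norm (a' - a) \<le> real m * s"
    and "y \<in> (\<Inter>i\<in>{1..m}. argmin_set X (f i)) \<Longrightarrow> (norm (a' - y))\<^sup>2 \<le> (norm (a - y))\<^sup>2 + real m * s\<^sup>2"
    and "\<lbrakk>y \<in> (\<Inter>i\<in>{1..m}. argmin_set X (f i));
          total_objective m f a \<ge> min_value X (total_objective m f) + \<epsilon>;
          \<And>r. 0 \<le> r \<Longrightarrow> r \<le> \<delta> \<Longrightarrow> C * r powr p < \<epsilon> / (2 * real m);
          real m * s \<le> \<delta>\<rbrakk>
        \<Longrightarrow> (norm (a' - y))\<^sup>2 \<le> (norm (a - y))\<^sup>2 - s * \<delta>"
proof -
  obtain z where z: "z 0 = a" "z m = a'"
    and step: "\<And>i. i \<in> {1..m} \<Longrightarrow>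
          if f i (z (i - 1)) = min_value X (f i) then z i = z (i - 1)
          else (\<exists>g \<in> quasi_subdifferential (f i) (z (i - 1)) \<inter> sphere 0 1.
                  z i = closest_point X (z (i - 1) - s *\<^sub>R g))"
    using pass unfolding incremental_pass_def by blast
  have "X \<noteq> {}" using a by blast
  have zX: "z i \<in> X" if "i \<le> m" for i
    using that
  proof (induction i)
    case (Suc i)
    then show ?case
      using step[of "Suc i"] closest_point_in_set[OF X(1) \<open>X \<noteq> {}\<close>] by (auto split: if_splits)
  qed (use z a in simp)
  then show "a' \<in> X" using z by auto
  have move: "norm (z i - z (i - 1)) \<le> s" if i: "i \<in> {1..m}" for i
  proof (cases "f i (z (i - 1)) = min_value X (f i)")
    case False
    then obtain g where g: "norm g = 1" "z i = closest_point X (z (i - 1) - s *\<^sub>R g)"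
      using step[OF i] by auto
    have "z (i - 1) \<in> X" using i by (intro zX) auto
    from projected_step_dist[OF X this g(1), of "z (i - 1)" s]
    have "(norm (z i - z (i - 1)))\<^sup>2 \<le> s\<^sup>2" using g(2) by simp
    then show ?thesis by (rule power2_le_imp_le) (use s in simp)
  qed (use step[OF i] s in auto)
  have far: "norm (z i - a) \<le> real i * s" if "i \<le> m" for i
    using that
  proof (induction i)
    case (Suc i)
    have "norm (z (Suc i) - a) \<le> norm (z (Suc i) - z i) + norm (z i - a)"
      using norm_triangle_ineq[of "z (Suc i) - z i" "z i - a"] by simp
    then show ?case using Suc move[of "Suc i"] by (simp add: algebra_simps)
  qed (use z in simp)
  show "norm (a' - a) \<le> real m * s" using far[of m] z by simp
  \<comment> \<open>A component that is skipped fits the same estimate with \<open>r = 0\<close>.\<close>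
  have progress: "\<exists>r\<ge>0. f i (z (i - 1)) - min_value X (f i) \<le> C * r powr p \<and>
      (norm (z i - y))\<^sup>2 \<le> (norm (z (i - 1) - y))\<^sup>2 - 2 * s * r + s\<^sup>2"
    if i: "i \<in> {1..m}" and y: "y \<in> argmin_set X (f i)" for i y
  proof (cases "f i (z (i - 1)) = min_value X (f i)")
    case True
    then show ?thesis using step[OF i] by (intro exI[of _ 0]) simp
  next
    case False
    have "y \<in> X" using y by (simp add: mem_argmin_set_iff)
    have "z (i - 1) \<in> X" using i by (intro zX) auto
    then have less: "f i y < f i (z (i - 1))"
      using y False min_value_eq[OF y] by (force simp: mem_argmin_set_iff)
    obtain g where g: "norm g = 1" "g \<in> quasi_subdifferential (f i) (z (i - 1))"
        "z i = closest_point X (z (i - 1) - s *\<^sub>R g)"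
      using step[OF i] False by auto
    show ?thesis
    proof (intro exI conjI)
      show "0 \<le> g \<bullet> (z (i - 1) - y)"
        using quasi_subgradient_inner_less[OF cont[OF i] g(2,1) less] by (simp add: inner_simps)
      show "f i (z (i - 1)) - min_value X (f i) \<le> C * (g \<bullet> (z (i - 1) - y)) powr p"
        unfolding min_value_eq[OF y] using hoelder[OF i \<open>y \<in> X\<close>]
        by (rule hoelder_gap_le[OF cont[OF i] g(2,1) less])
      show "(norm (z i - y))\<^sup>2 \<le> (norm (z (i - 1) - y))\<^sup>2 - 2 * s * (g \<bullet> (z (i - 1) - y)) + s\<^sup>2"
        using projected_step_dist[OF X \<open>y \<in> X\<close> g(1)] g(3) by simp
    qed
  qed
  have grow: "(norm (z i - y))\<^sup>2 \<le> (norm (z (i - 1) - y))\<^sup>2 + s\<^sup>2"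
    if "i \<in> {1..m}" "y \<in> argmin_set X (f i)" for i y
    using progress[OF that] s by (smt (verit) mult_nonneg_nonneg)
  show "(norm (a' - y))\<^sup>2 \<le> (norm (a - y))\<^sup>2 + real m * s\<^sup>2"
    if y: "y \<in> (\<Inter>i\<in>{1..m}. argmin_set X (f i))"
    using chain_estimate[of m "\<lambda>i. (norm (z i - y))\<^sup>2" "s\<^sup>2" 1 0] grow[of _ y] grow[of 1 y] y m z by simp
  show "(norm (a' - y))\<^sup>2 \<le> (norm (a - y))\<^sup>2 - s * \<delta>"
    if y: "y \<in> (\<Inter>i\<in>{1..m}. argmin_set X (f i))"
      and big: "total_objective m f a \<ge> min_value X (total_objective m f) + \<epsilon>"
      and small: "\<And>r. 0 \<le> r \<Longrightarrow> r \<le> \<delta> \<Longrightarrow> C * r powr p < \<epsilon> / (2 * real m)"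
      and ms: "real m * s \<le> \<delta>"
  proof -
    have "\<exists>i\<in>{1..m}. f i a - min_value X (f i) \<ge> \<epsilon> / real m"
    proof (rule ccontr)
      assume "\<not> ?thesis"
      then have "(\<Sum>i=1..m. f i a - min_value X (f i)) < (\<Sum>i=1..m. \<epsilon> / real m)"
        using m by (intro sum_strict_mono) (auto simp: not_le)
      then show False
        using big argmin_total_objective(2)[OF common m] m
        by (simp add: total_objective_def sum_subtractf)
    qed
    then obtain i where i: "i \<in> {1..m}" and gap: "f i a - min_value X (f i) \<ge> \<epsilon> / real m" by blast
    have "norm (z (i - 1) - a) \<le> real (i - 1) * s" using i by (intro far) auto
    also have "\<dots> \<le> real m * s" using i s by (intro mult_right_mono) auto
    also note ms
    finally have "C * norm (z (i - 1) - a) powr p < \<epsilon> / (2 * real m)" by (intro small) auto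
    moreover have "\<epsilon> / real m = \<epsilon> / (2 * real m) + \<epsilon> / (2 * real m)" using m by (simp add: field_simps)
    ultimately have gap': "f i (z (i - 1)) - min_value X (f i) \<ge> \<epsilon> / (2 * real m)"
      using gap hoelder[OF i a, of "z (i - 1)"] by linarith
    obtain r where r: "r \<ge> 0" "f i (z (i - 1)) - min_value X (f i) \<le> C * r powr p"
      "(norm (z i - y))\<^sup>2 \<le> (norm (z (i - 1) - y))\<^sup>2 - 2 * s * r + s\<^sup>2"
      using progress[OF i, of y] y i by blast
    have "r > \<delta>" using small[of r] r(1,2) gap' by linarith
    then have "s * r \<ge> s * \<delta>" using s by simp
    then have "(norm (z i - y))\<^sup>2 \<le> (norm (z (i - 1) - y))\<^sup>2 + s\<^sup>2 - 2 * s * \<delta>"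
      using r(3) by linarith
    then have "(norm (a' - y))\<^sup>2 \<le> (norm (a - y))\<^sup>2 + real m * s\<^sup>2 - 2 * s * \<delta>"
      using chain_estimate[of m "\<lambda>i. (norm (z i - y))\<^sup>2" "s\<^sup>2" i "2 * s * \<delta>"] grow[of _ y] y i z
      by simp
    moreover have "real m * s\<^sup>2 \<le> s * \<delta>"
      using mult_left_mono[OF ms, of s] s by (simp add: power2_eq_square algebra_simps)
    ultimately show ?thesis by linarith
  qed
qed

text \<open>
  A pass stays at an infeasible point \<open>a\<close> only while the components there have the values
  \<open>min_value X (f i)\<close>; that this fails for some component is what \<open>neq\<close> provides.
  The first other component projects the point onto \<open>X\<close>.
\<close>
lemma incremental_pass_enters:
  assumes "closed X" "X \<noteq> {}"
    and neq: "total_objective m f a \<noteq> (\<Sum>i=1..m. min_value X (f i))"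
    and pass: "incremental_pass X m f s a a'"
  shows "a' \<in> X"
proof -
  obtain z where z: "z 0 = a" "z m = a'"
    and step: "\<And>i. i \<in> {1..m} \<Longrightarrow>
          if f i (z (i - 1)) = min_value X (f i) then z i = z (i - 1)
          else (\<exists>g \<in> quasi_subdifferential (f i) (z (i - 1)) \<inter> sphere 0 1.
                  z i = closest_point X (z (i - 1) - s *\<^sub>R g))"
    using pass unfolding incremental_pass_def by blast
  have "z j \<in> X \<or> z j = a \<and> (\<forall>i\<in>{1..j}. f i a = min_value X (f i))" if "j \<le> m" for j
    using that
  proof (induction j)
    case (Suc j)
    have "z (Suc j) \<in> X \<or> z (Suc j) = z j \<and> f (Suc j) (z j) = min_value X (f (Suc j))"
      using step[of "Suc j"] Suc.prems closest_point_in_set[OF assms(1,2)] by (auto split: if_splits)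
    then show ?case using Suc by (auto simp: le_Suc_eq)
  qed (use z in simp)
  from this[of m] show ?thesis using z neq by (auto simp: total_objective_def)
qed

section \<open>Convergence of the incremental subgradient method\<close>

theorem theorem3p2:
  fixes X :: "(real ^ 'n) set" and m :: nat
    and f :: "nat \<Rightarrow> real ^ 'n \<Rightarrow> real"
    and p :: real and L :: "nat \<Rightarrow> real"
    and v :: "nat \<Rightarrow> real" and x :: "nat \<Rightarrow> real ^ 'n"
  assumes "X \<noteq> {}" "closed X" "convex X"
    and "m \<ge> 1"
    and "\<And>i. i \<in> {1..m} \<Longrightarrow> continuous_on UNIV (f i)"
    and "\<And>i. i \<in> {1..m} \<Longrightarrow> quasi_convex (f i)"
    and common_optimum: "(\<Inter>i\<in>{1..m}. argmin_set X (f i)) \<noteq> {}"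
    and "p > 0"
    and "\<And>i. i \<in> {1..m} \<Longrightarrow> L i > 0"
    and hoelder: "\<And>i a b. i \<in> {1..m} \<Longrightarrow> a \<in> X \<Longrightarrow>
                    \<bar>f i b - f i a\<bar> \<le> L i * norm (b - a) powr p"
    and "\<And>k. v k > 0"
    and "v \<longlonglongrightarrow> 0"
    and "filterlim (\<lambda>N. \<Sum>k<N. v k) at_top sequentially"
    and generated: "incremental_subgradient_seq X m f v x"
    \<comment> \<open>only excludes stopping before the first pass at an infeasible starting point\<close>
    and start: "x 0 \<in> X \<or> total_objective m f (x 0) > min_value X (total_objective m f)"
  shows "liminf (\<lambda>k. ereal (total_objective m f (x k))) = ereal (min_value X (total_objective m f)) \<and>
    (filterlim (total_objective m f) at_top at_infinity \<longrightarrow>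
       (\<lambda>k. total_objective m f (x k)) \<longlonglongrightarrow> min_value X (total_objective m f) \<and>
       (\<lambda>k. infdist (x k) (argmin_set X (total_objective m f))) \<longlonglongrightarrow> 0) \<and>
    (summable (\<lambda>k. (v k)\<^sup>2) \<longrightarrow> (\<exists>z \<in> argmin_set X (total_objective m f). x \<longlonglongrightarrow> z))"
proof -
  define F where "F = total_objective m f"
  define Fmin where "Fmin = min_value X F"
  define S where "S = argmin_set X F"
  define C where "C = (\<Sum>i=1..m. L i)"
  have S_Inter: "S = (\<Inter>i\<in>{1..m}. argmin_set X (f i))"
    and Fmin_sum: "Fmin = (\<Sum>i=1..m. min_value X (f i))"
    unfolding S_def Fmin_def F_def using argmin_total_objective[OF common_optimum assms(4)] by auto
  have "S \<noteq> {}" using common_optimum S_Inter by simp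
  have S_eq: "S = {y \<in> X. F y = Fmin}"
    using argmin_set_eq \<open>S \<noteq> {}\<close> unfolding S_def Fmin_def by blast
  have L_le: "L i \<le> C" if "i \<in> {1..m}" for i
    unfolding C_def using that assms(9) by (intro member_le_sum) (auto intro: less_imp_le)
  have "C > 0" using L_le[of 1] assms(4) assms(9)[of 1] by fastforce
  have hoelder_C: "\<bar>f i b - f i a\<bar> \<le> C * norm (b - a) powr p" if "i \<in> {1..m}" "a \<in> X" for i a b
    using hoelder[OF that, of b] mult_right_mono[OF L_le[OF that(1)], of "norm (b - a) powr p"] by simp
  have run: "if F (x k) > Fmin then incremental_pass X m f (v k) (x k) (x (Suc k)) else x (Suc k) = x k" for k
    using generated unfolding incremental_subgradient_seq_def F_def Fmin_def by blast
  have enters: "x (Suc k) \<in> X" if "F (x k) > Fmin" for k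
  proof (rule incremental_pass_enters[OF assms(2,1)])
    show "total_objective m f (x k) \<noteq> (\<Sum>i=1..m. min_value X (f i))"
      using that Fmin_sum by (simp add: F_def)
    show "incremental_pass X m f (v k) (x k) (x (Suc k))" using run[of k] that by simp
  qed
  \<comment> \<open>The starting point itself may be infeasible, so feasibility is only claimed after one pass.\<close>
  have in_X: "x (Suc k) \<in> X" for k
  proof (induction k)
    case 0
    then show ?case using start enters[of 0] run[of 0] by (auto simp: F_def Fmin_def split: if_splits)
  next
    case (Suc k)
    then show ?case using enters[of "Suc k"] run[of "Suc k"] by (auto split: if_splits)
  qed
  have eventually_in_X: "eventually (\<lambda>k. x k \<in> X) sequentially"
    unfolding eventually_sequentially using in_X by (metis Suc_le_D)
  note est = incremental_pass_estimates[OF assms(2,3) assms(11) _ assms(5) common_optimum hoelder_C assms(4)]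
  interpret quasi_fejer X F Fmin "real m" v x S
  proof
    show "continuous_on X F"
      unfolding F_def total_objective_def
      using assms(5) by (intro continuous_on_sum continuous_on_subset[of UNIV _ X]) auto
    show "Fmin \<le> F y" if "y \<in> X" for y
      using that \<open>S \<noteq> {}\<close> min_value_eq[of _ X F]
      unfolding S_def Fmin_def by (force simp: mem_argmin_set_iff)
    show "eventually (\<lambda>k. norm (x (Suc k) - x k) \<le> real m * v k) sequentially"
      using eventually_in_X
    proof eventually_elim
      case (elim k)
      show ?case
        using run[of k] est(2)[OF elim] assms(11)[of k] by (cases "F (x k) > Fmin") auto
    qed
    show "eventually (\<lambda>k. \<forall>y\<in>S. (norm (x (Suc k) - y))\<^sup>2
            \<le> (norm (x k - y))\<^sup>2 + real m * (v k)\<^sup>2) sequentially"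
      using eventually_in_X
    proof eventually_elim
      case (elim k)
      show ?case
        using run[of k] est(3)[OF elim] unfolding S_Inter by (cases "F (x k) > Fmin") auto
    qed
    show "\<exists>\<delta>>0. eventually (\<lambda>k. F (x k) \<ge> Fmin + \<epsilon> \<longrightarrow>
            (\<forall>y\<in>S. (norm (x (Suc k) - y))\<^sup>2 \<le> (norm (x k - y))\<^sup>2 - v k * \<delta>)) sequentially"
      if "\<epsilon> > 0" for \<epsilon>
    proof -
      obtain \<delta> where \<delta>: "\<delta> > 0" "\<And>r. 0 \<le> r \<Longrightarrow> r \<le> \<delta> \<Longrightarrow> C * r powr p < \<epsilon> / (2 * real m)"
        using powr_small[OF \<open>p > 0\<close> _ \<open>C > 0\<close>, of "\<epsilon> / (2 * real m)"] \<open>\<epsilon> > 0\<close> assms(4) by auto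
      have "eventually (\<lambda>k. real m * v k < \<delta>) sequentially"
        using tendsto_mult_right_zero[OF assms(12), of "real m"] \<delta>(1) by (rule order_tendstoD)
      with eventually_in_X
      have "eventually (\<lambda>k. F (x k) \<ge> Fmin + \<epsilon> \<longrightarrow>
            (\<forall>y\<in>S. (norm (x (Suc k) - y))\<^sup>2 \<le> (norm (x k - y))\<^sup>2 - v k * \<delta>)) sequentially"
      proof eventually_elim
        case (elim k)
        show ?case
        proof (intro impI ballI)
          fix y assume big: "F (x k) \<ge> Fmin + \<epsilon>" and y: "y \<in> S"
          have "incremental_pass X m f (v k) (x k) (x (Suc k))"
            using run[of k] big \<open>\<epsilon> > 0\<close> by auto
          from est(4)[OF elim(1) _ _ _ this _ _ \<delta>(2)]
          show "(norm (x (Suc k) - y))\<^sup>2 \<le> (norm (x k - y))\<^sup>2 - v k * \<delta>"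
            using big y elim(2) unfolding S_Inter F_def Fmin_def by auto
        qed
      qed
      with \<delta>(1) show ?thesis by blast
    qed
  qed (use assms(2,11-13) S_eq \<open>S \<noteq> {}\<close> eventually_in_X in auto)
  show ?thesis
    using liminf_eq coercive_value_tendsto coercive_infdist_tendsto square_summable_tendsto
    unfolding F_def Fmin_def S_def by blast
qed

end
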